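(* Let $n\ge 2$ and $a\ge 2\sqrt{n-1}$, let $f(x)=a|x^{(1)}|+\sum_{i=2}^n x^{(i)}$ on $\mathbb{R}^n$, and let $$b=\frac{a-\sqrt{a^2-3(n-1)}}{3(n-1)}.$$ Suppose the Armijo parameter $c_1$ is chosen large enough that $$\frac{1}{c_1}-1<\frac{a}{(n-1)b}.$$ Then, using any Armijo-Wolfe line search and any starting point $x_0$ with $x_0^{(1)}\ne 0$, scaled memoryless BFGS applied to $f$ fails in the sense that $f(x_N)$ is bounded below as $N\to\infty$.
   Context: Superscript $(i)$ denotes the $i$-th component of a vector. The function $f$ is differentiable exactly at points with $x^{(1)}\neq 0$. Fix parameters $0<c_1<c_2<1$ (the Armijo and Wolfe parameters). Given $x$ at which $f$ is differentiable and a direction $d$ with $\nabla f(x)^Td<0$, a steplength $t>0$ satisfies the Armijo condition if $f(x+td)\le f(x)+c_1t\nabla f(x)^Td$, and the Wolfe condition if $\nabla f(x+td)$ exists and $\nabla f(x+td)^Td\ge c_2\nabla f(x)^Td$. An Armijo-Wolfe line search is any rule returning some $t$ satisfying both conditions. Scaled memoryless BFGS (with input $x_0$): set $d_0=-\nabla f(x_0)$. For $k=1,2,3,\dots$: let $t_{k-1}$ be a steplength satisfying the Armijo and Wolfe conditions at $x_{k-1}$ along $d_{k-1}$ (if none exists, terminate); set $x_k=x_{k-1}+t_{k-1}d_{k-1}$, $s_{k-1}=x_k-x_{k-1}$, $y_{k-1}=\nabla f(x_k)-\nabla f(x_{k-1})$, $V_{k-1}=I-\dfrac{y_{k-1}s_{k-1}^T}{y_{k-1}^Ts_{k-1}}$,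 $H_k=\dfrac{s_{k-1}^Ty_{k-1}}{y_{k-1}^Ty_{k-1}}V_{k-1}^TV_{k-1}+\dfrac{s_{k-1}s_{k-1}^T}{s_{k-1}^Ty_{k-1}}$, and $d_k=-H_k\nabla f(x_k)$. *)

theory Defs
  imports "HOL-Analysis.Analysis" "HOL-Library.Extended_Nat"
begin

text \<open>
  The distinguished coordinate \<open>p\<close> plays the role of the first coordinate; the coordinates
  in \<open>UNIV - {p}\<close> are the remaining \<open>n - 1\<close> ones, where \<open>n = CARD('n)\<close>.
\<close>
definition abs_lin :: "'n::finite \<Rightarrow> real \<Rightarrow> real ^ 'n \<Rightarrow> real" where
  "abs_lin p a x = a * \<bar>x $ p\<bar> + (\<Sum>i\<in>UNIV - {p}. x $ i)"

definition gradient :: "('a::real_inner \<Rightarrow> real) \<Rightarrow> 'a \<Rightarrow> 'a" where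
  "gradient f x = (THE g. GDERIV f x :> g)"

definition armijo :: "('a::real_inner \<Rightarrow> real) \<Rightarrow> real \<Rightarrow> 'a \<Rightarrow> 'a \<Rightarrow> real \<Rightarrow> bool" where
  "armijo f c1 x d t \<longleftrightarrow> f (x + t *\<^sub>R d) \<le> f x + c1 * t * (gradient f x \<bullet> d)"

definition wolfe :: "('a::real_inner \<Rightarrow> real) \<Rightarrow> real \<Rightarrow> 'a \<Rightarrow> 'a \<Rightarrow> real \<Rightarrow> bool" where
  "wolfe f c2 x d t \<longleftrightarrow>
     (\<exists>g. GDERIV f (x + t *\<^sub>R d) :> g) \<and>
     gradient f (x + t *\<^sub>R d) \<bullet> d \<ge> c2 * (gradient f x \<bullet> d)"

definition armijo_wolfe_step ::
  "('a::real_inner \<Rightarrow> real) \<Rightarrow> real \<Rightarrow> real \<Rightarrow> 'a \<Rightarrow> 'a \<Rightarrow> real \<Rightarrow> bool" where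
  "armijo_wolfe_step f c1 c2 x d t \<longleftrightarrow> t > 0 \<and> armijo f c1 x d t \<and> wolfe f c2 x d t"

definition outer :: "real ^ 'n \<Rightarrow> real ^ 'n \<Rightarrow> real ^ 'n ^ 'n" where
  "outer u v = (\<chi> i j. u $ i * v $ j)"

definition bfgs_V :: "real ^ 'n::finite \<Rightarrow> real ^ 'n \<Rightarrow> real ^ 'n ^ 'n" where
  "bfgs_V s y = mat 1 - (1 / (y \<bullet> s)) *\<^sub>R outer y s"

definition bfgs_H :: "real ^ 'n::finite \<Rightarrow> real ^ 'n \<Rightarrow> real ^ 'n ^ 'n" where
  "bfgs_H s y = ((s \<bullet> y) / (y \<bullet> y)) *\<^sub>R (transpose (bfgs_V s y) ** bfgs_V s y)
              + (1 / (s \<bullet> y)) *\<^sub>R outer s s"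

text \<open>
  A run records iterates \<open>x\<close>, directions \<open>d\<close> and steplengths \<open>t\<close>. It performs \<open>K\<close> iterations,
  where \<open>K = \<infinity>\<close> means that it never terminates and a finite \<open>K\<close> means that no Armijo-Wolfe
  steplength exists at \<open>x K\<close> along \<open>d K\<close>; in the latter case the entries beyond \<open>x K\<close> and \<open>d K\<close>
  are irrelevant. Since \<open>t\<close> is constrained only by the two conditions, any line search rule
  (including a history-dependent one) is covered.
\<close>
definition memoryless_bfgs_run ::
  "(real ^ 'n::finite \<Rightarrow> real) \<Rightarrow> real \<Rightarrow> real \<Rightarrow> real ^ 'n \<Rightarrow> enat \<Rightarrow>
   (nat \<Rightarrow> real ^ 'n) \<Rightarrow> (nat \<Rightarrow> real ^ 'n) \<Rightarrow> (nat \<Rightarrow> real) \<Rightarrow> bool" where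
  "memoryless_bfgs_run f c1 c2 x0 K x d t \<longleftrightarrow>
     x 0 = x0 \<and> d 0 = - gradient f x0 \<and>
     (\<forall>k. enat k < K \<longrightarrow>
        armijo_wolfe_step f c1 c2 (x k) (d k) (t k) \<and>
        x (Suc k) = x k + t k *\<^sub>R d k \<and>
        d (Suc k) = - (bfgs_H (x (Suc k) - x k) (gradient f (x (Suc k)) - gradient f (x k))
                         *v gradient f (x (Suc k)))) \<and>
     (\<forall>k. K = enat k \<longrightarrow> (\<nexists>\<tau>. armijo_wolfe_step f c1 c2 (x k) (d k) \<tau>))"

end

theory Submission imports Defs begin

text \<open>
  Along a descent direction the slope of \<open>f\<close> is constant until \<open>x\<^sup>(\<^sup>1\<^sup>)\<close> changes sign, so the Wolfe
  condition forces a sign change at every step. Hence \<open>y\<close> is always \<open>\<plusminus>2a e\<^sub>1\<close>, and the last \<open>n - 1\<close>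
  components of the direction, all equal, keep a ratio \<open>-u\<^sub>k\<close> to the absolute value of the first one,
  with \<open>u\<^sub>k\<close> iterating a fixed rational map from \<open>u\<^sub>0 = 1/a\<close>. This map contracts towards its fixed
  point \<open>b\<close>, since \<open>a\<^sup>2 \<ge> 4(n - 1)\<close>. Writing \<open>z\<^sub>k = \<bar>x\<^sub>k\<^sup>(\<^sup>1\<^sup>)\<bar>\<close>, the sign change gives
  \<open>t\<^sub>k \<bar>d\<^sub>k\<^sup>(\<^sup>1\<^sup>)\<bar> = z\<^sub>k + z\<^sub>k\<^sub>+\<^sub>1\<close>, and the Armijo condition becomes \<open>z\<^sub>k\<^sub>+\<^sub>1 \<le> R(u\<^sub>k) z\<^sub>k\<close>. The hypothesis on
  \<open>c\<^sub>1\<close> says exactly that \<open>R(b) < 1\<close>, so \<open>z\<close> is summable, and the total decrease of \<open>f\<close>, of order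
  \<open>\<Sum> z\<^sub>k + z\<^sub>k\<^sub>+\<^sub>1\<close>, is finite.
\<close>

section \<open>Vectors symmetric in the coordinates other than \<open>p\<close>\<close>

text \<open>All gradients and search directions of a run have this shape, so two reals describe each
  of them.\<close>

definition split_vec :: "'n::finite \<Rightarrow> real \<Rightarrow> real \<Rightarrow> real ^ 'n" where
  "split_vec p \<alpha> \<beta> = (\<chi> i. if i = p then \<alpha> else \<beta>)"

lemma split_vec_nth [simp]: "split_vec p \<alpha> \<beta> $ i = (if i = p then \<alpha> else \<beta>)"
  by (simp add: split_vec_def)

lemma split_vec_arith:
  "split_vec p \<alpha> \<beta> + split_vec p \<gamma> \<delta> = split_vec p (\<alpha> + \<gamma>) (\<beta> + \<delta>)"
  "split_vec p \<alpha> \<beta> - split_vec p \<gamma> \<delta> = split_vec p (\<alpha> - \<gamma>) (\<beta> - \<delta>)"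
  "- split_vec p \<alpha> \<beta> = split_vec p (- \<alpha>) (- \<beta>)"
  "r *\<^sub>R split_vec p \<alpha> \<beta> = split_vec p (r * \<alpha>) (r * \<beta>)"
  by (auto simp: vec_eq_iff)

lemma inner_split_vec_right:
  fixes v :: "real ^ 'n::finite"
  shows "v \<bullet> split_vec p \<alpha> \<beta> = \<alpha> * v $ p + \<beta> * (\<Sum>i\<in>UNIV - {p}. v $ i)"
  by (simp add: inner_vec_def sum.remove[of UNIV p] sum_distrib_left mult.commute)

lemma inner_split_vec:
  fixes p :: "'n::finite"
  shows "split_vec p \<alpha> \<beta> \<bullet> split_vec p \<gamma> \<delta> = \<alpha> * \<gamma> + (real CARD('n) - 1) * (\<beta> * \<delta>)"
proof -
  have "real (CARD('n) - 1) = real CARD('n) - 1"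
    by (simp add: of_nat_diff Suc_leI)
  then show ?thesis
    by (simp add: inner_split_vec_right algebra_simps card_Diff_singleton)
qed

lemma abs_lin_line:
  fixes p :: "'n::finite"
  shows "abs_lin p a (x + r *\<^sub>R split_vec p \<alpha> \<beta>)
    = abs_lin p a x + a * (\<bar>x $ p + r * \<alpha>\<bar> - \<bar>x $ p\<bar>) + (real CARD('n) - 1) * (r * \<beta>)"
proof -
  have "real (CARD('n) - 1) = real CARD('n) - 1"
    by (simp add: of_nat_diff Suc_leI)
  then show ?thesis
    by (simp add: abs_lin_def sum.distrib card_Diff_singleton algebra_simps)
qed

section \<open>Differentiability of the objective\<close>

lemma GDERIV_abs_lin:
  fixes x :: "real ^ 'n::finite"
  assumes "x $ p \<noteq> 0"
  shows "GDERIV (abs_lin p a) x :> split_vec p (a * sgn (x $ p)) 1"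
proof -
  have "((\<lambda>y. sgn (x $ p) * y $ p) has_derivative (\<lambda>h. sgn (x $ p) * h $ p)) (at x)"
    by (intro has_derivative_mult_right bounded_linear_imp_has_derivative bounded_linear_vec_nth)
  then have "((\<lambda>y. \<bar>y $ p\<bar>) has_derivative (\<lambda>h. sgn (x $ p) * h $ p)) (at x)"
  proof (rule has_derivative_transform_within_open)
    \<comment> \<open>Near \<open>x\<close> the sign of coordinate \<open>p\<close> is constant, so
      its absolute value is linear there.\<close>
    show "open {y. 0 < sgn (x $ p) * y $ p}"
      by (intro open_Collect_less continuous_intros)
  qed (use assms in \<open>auto simp: sgn_if split: if_splits\<close>)
  moreover have "((\<lambda>x. \<Sum>i\<in>UNIV - {p}. x $ i) has_derivative (\<lambda>h. \<Sum>i\<in>UNIV - {p}. h $ i)) (at x)"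
    by (intro bounded_linear_imp_has_derivative bounded_linear_sum bounded_linear_vec_nth)
  ultimately show ?thesis
    unfolding gderiv_def abs_lin_def
    by (rule has_derivative_eq_rhs[OF has_derivative_add[OF has_derivative_mult_right]])
       (simp_all add: inner_split_vec_right fun_eq_iff)
qed

lemma gradient_eq:
  assumes "GDERIV f x :> g"
  shows "gradient f x = g"
  unfolding gradient_def
proof (rule the_equality)
  fix g' assume "GDERIV f x :> g'"
  then have "(\<lambda>h. h \<bullet> g') = (\<lambda>h. h \<bullet> g)"
    using assms unfolding gderiv_def by (rule has_derivative_unique)
  then show "g' = g"
    by (metis vector_eq_ldot)
qed (fact assms)

lemma gradient_abs_lin:
  fixes x :: "real ^ 'n::finite"
  assumes "x $ p \<noteq> 0"
  shows "gradient (abs_lin p a) x = split_vec p (a * sgn (x $ p)) 1"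
  by (rule gradient_eq[OF GDERIV_abs_lin[OF assms]])

text \<open>On the line through \<open>x\<close> along the axis \<open>p\<close>, the function is a
  constant plus \<open>a * \<bar>r\<bar>\<close>, whose difference quotients at 0 tend to
  \<open>a\<close> from the right and to \<open>- a\<close> from the left. Hence no Wolfe step ends
  on the kink.\<close>

lemma not_GDERIV_abs_lin:
  fixes x :: "real ^ 'n::finite"
  assumes "x $ p = 0" and "a \<noteq> 0"
  shows "\<not> GDERIV (abs_lin p a) x :> g"
proof
  let ?e = "split_vec p 1 0 :: real ^ 'n"
  assume "GDERIV (abs_lin p a) x :> g"
  then have "(abs_lin p a has_derivative (\<lambda>h. h \<bullet> g)) (at (x + 0 *\<^sub>R ?e))"
    by (simp add: gderiv_def)
  moreover have "((\<lambda>r. x + r *\<^sub>R ?e) has_derivative (\<lambda>r. r *\<^sub>R ?e)) (at (0::real))"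
    by (auto intro!: derivative_eq_intros)
  ultimately have "((\<lambda>r. abs_lin p a (x + r *\<^sub>R ?e)) has_derivative
      (\<lambda>r. (r *\<^sub>R ?e) \<bullet> g)) (at 0)"
    by (rule has_derivative_compose[rotated])
  then have "((\<lambda>r. abs_lin p a x + a * \<bar>r\<bar>) has_derivative (\<lambda>r. r * (?e \<bullet> g))) (at 0)"
    by (simp add: abs_lin_line assms)
  then have "DERIV (\<lambda>r. abs_lin p a x + a * \<bar>r\<bar>) 0 :> ?e \<bullet> g"
    by (rule has_derivative_imp_has_field_derivative) simp
  then have "((\<lambda>h. a * \<bar>h\<bar> / h) \<longlongrightarrow> ?e \<bullet> g) (at 0)"
    by (simp add: DERIV_def)
  then have "((\<lambda>h. a * \<bar>h\<bar> / h) \<longlongrightarrow> ?e \<bullet> g) (at_right 0)"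
    and "((\<lambda>h. a * \<bar>h\<bar> / h) \<longlongrightarrow> ?e \<bullet> g) (at_left 0)"
    by (auto simp: filterlim_at_split)
  moreover have "((\<lambda>h. a * \<bar>h\<bar> / h) \<longlongrightarrow> a) (at_right 0)"
    by (rule Lim_transform_eventually[OF tendsto_const]) (auto simp: eventually_at_filter)
  moreover have "((\<lambda>h. a * \<bar>h\<bar> / h) \<longlongrightarrow> - a) (at_left 0)"
    by (rule Lim_transform_eventually[OF tendsto_const]) (auto simp: eventually_at_filter)
  ultimately have "a = - a"
    using tendsto_unique[OF trivial_limit_at_right_real] tendsto_unique[OF trivial_limit_at_left_real]
    by metis
  then show False using \<open>a \<noteq> 0\<close> by simp
qed

section \<open>Action of the BFGS matrix on vectors\<close>

lemma outer_mult_vec: "outer u v *v w = (v \<bullet> w) *\<^sub>R u"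
  by (simp add: vec_eq_iff outer_def matrix_vector_mult_def inner_vec_def sum_distrib_left
      sum_distrib_right mult_ac)

lemma bfgs_V_mult_vec: "bfgs_V s y *v w = w - ((s \<bullet> w) / (y \<bullet> s)) *\<^sub>R y"
  by (simp add: bfgs_V_def matrix_vector_mult_diff_rdistrib scaleR_matrix_vector_assoc[symmetric]
      outer_mult_vec)

lemma transpose_bfgs_V_mult_vec:
  "transpose (bfgs_V s y) *v w = w - ((y \<bullet> w) / (y \<bullet> s)) *\<^sub>R s"
proof -
  have "transpose (bfgs_V s y) = mat 1 - (1 / (y \<bullet> s)) *\<^sub>R outer s y"
    by (auto simp: bfgs_V_def vec_eq_iff transpose_def outer_def mat_def mult.commute)
  then show ?thesis
    by (simp add: matrix_vector_mult_diff_rdistrib scaleR_matrix_vector_assoc[symmetric]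
      outer_mult_vec)
qed

lemma bfgs_H_mult_vec:
  "bfgs_H s y *v w = ((s \<bullet> y) / (y \<bullet> y)) *\<^sub>R (transpose (bfgs_V s y) *v (bfgs_V s y *v w))
    + ((s \<bullet> w) / (s \<bullet> y)) *\<^sub>R s"
  by (simp add: bfgs_H_def matrix_vector_mult_add_rdistrib scaleR_matrix_vector_assoc[symmetric]
      outer_mult_vec matrix_vector_mul_assoc)

text \<open>
  Every search direction is a positive multiple of \<open>split_vec p (\<plusminus>1) (- u)\<close>; one BFGS step replaces
  \<open>u\<close> by \<open>slope_map m a u\<close>, where \<open>m = n - 1\<close>.
\<close>

definition slope_map :: "real \<Rightarrow> real \<Rightarrow> real \<Rightarrow> real" where
  "slope_map m a u = (1 + 2 * m * u\<^sup>2 - a * u) / (a - m * u)"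

text \<open>Because \<open>y\<close> lies along the axis \<open>p\<close>, the product of
  \<open>transpose V\<close> and \<open>V\<close> sends the gradient to a vector with component 0 at
  \<open>p\<close> and \<open>1 + m * u\<^sup>2\<close> elsewhere. The component at \<open>p\<close>
  of the result thus comes from the rank-one term alone, and adding both terms elsewhere produces
  the numerator of \<open>slope_map\<close>.\<close>

lemma bfgs_direction:
  fixes p :: "'n::finite"
  assumes "\<sigma> = 1 \<or> \<sigma> = -1" and "D > 0" "t > 0" "a > 0"
    and "m = real CARD('n) - 1" and "a - m * u > 0"
  shows "bfgs_H (t *\<^sub>R split_vec p (\<sigma> * D) (- (u * D))) (split_vec p (2 * a * \<sigma>) 0)
      *v split_vec p (a * \<sigma>) 1
    = (t * D * (a - m * u) / (2 * a)) *\<^sub>R split_vec p \<sigma> (slope_map m a u)"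
  using assms
  by (auto simp: bfgs_H_mult_vec bfgs_V_mult_vec transpose_bfgs_V_mult_vec split_vec_arith
      inner_split_vec vec_eq_iff slope_map_def field_simps power2_eq_square
      simp flip: assms(5) simp del: transpose_matrix_vector)

section \<open>The slope recursion and its fixed point\<close>

text \<open>\<open>b\<close> is the smaller root of the quadratic, which is
  \<open>slope_map m a b = b\<close> with the denominator cleared. The bound on \<open>a\<close>
  makes the square root at least \<open>a / 2\<close>, whence
  \<open>6 * (m * b) \<le> a\<close>.\<close>

lemma slope_fixpoint:
  fixes a b m :: real
  assumes "m > 0" and "a \<ge> 2 * sqrt m" and b: "b = (a - sqrt (a\<^sup>2 - 3 * m)) / (3 * m)"
  shows "3 * m * b\<^sup>2 - 2 * a * b + 1 = 0" "0 < b" "6 * (m * b) \<le> a" "b \<le> 1 / a" "a > 0" "4 * m \<le> a\<^sup>2"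
proof -
  show a: "a > 0"
    using assms(1,2) by (smt (verit) real_sqrt_gt_zero)
  have "(2 * sqrt m)\<^sup>2 \<le> a\<^sup>2"
    using assms by (intro power_mono) auto
  then show am: "4 * m \<le> a\<^sup>2"
    using assms(1) by (simp add: power_mult_distrib)
  define r where "r = sqrt (a\<^sup>2 - 3 * m)"
  have r2: "r\<^sup>2 = a\<^sup>2 - 3 * m"
    unfolding r_def using am assms(1) by (intro real_sqrt_pow2) linarith
  have ra: "a - r = 3 * m * b"
    using b assms(1) by (simp add: r_def)
  have "r < a"
    unfolding r_def using a assms(1) by (intro real_less_lsqrt) auto
  then show "0 < b"
    using b assms(1) by (simp add: r_def)
  have "a / 2 \<le> r"
    unfolding r_def using am a by (intro real_le_rsqrt) (simp add: power_divide)
  then show mb: "6 * (m * b) \<le> a"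
    using ra by simp
  have "(a - 3 * m * b)\<^sup>2 = a\<^sup>2 - 3 * m"
    using r2 ra by (simp add: algebra_simps flip: ra)
  then have "3 * m * (3 * m * b\<^sup>2 - 2 * a * b + 1) = 0"
    by (simp add: power2_eq_square algebra_simps)
  then show eq: "3 * m * b\<^sup>2 - 2 * a * b + 1 = 0"
    using assms(1) by simp
  \<comment> \<open>By the quadratic, this product equals \<open>1 - a * b\<close>.\<close>
  have "b * (a - 3 * (m * b)) \<ge> 0"
    using \<open>0 < b\<close> mb a by (intro mult_nonneg_nonneg) auto
  then have "a * b \<le> 1"
    using eq by (simp add: power2_eq_square algebra_simps)
  then show "b \<le> 1 / a"
    using a by (simp add: field_simps)
qed

text \<open>Subtracting the fixed-point equation lets \<open>u - b\<close> factor out of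
  \<open>slope_map m a u - b\<close>; the cofactor \<open>q\<close> lies between
  \<open>3 * m * b / a - 1\<close> and 0. The radius \<open>1 / a - b\<close> is the distance from
  \<open>b\<close> to the starting value of the recursion.\<close>

lemma slope_map_contraction:
  fixes a b m u :: real
  assumes "m > 0" "a > 0" "b > 0" and fp: "3 * m * b\<^sup>2 - 2 * a * b + 1 = 0"
    and mb: "6 * (m * b) \<le> a" and am: "4 * m \<le> a\<^sup>2" and "\<bar>u - b\<bar> \<le> 1 / a - b"
  shows "0 \<le> u" "4 * (m * u) \<le> a"
    and "\<bar>slope_map m a u - b\<bar> \<le> (1 - 3 * m * b / a) * \<bar>u - b\<bar>"
proof -
  \<comment> \<open>\<open>2 * b - 1 / a\<close> is the left end of the interval allowed for
    \<open>u\<close>.\<close>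
  have "a * (2 * b - 1 / a) = 3 * m * b\<^sup>2"
    using fp \<open>a > 0\<close> by (simp add: right_diff_distrib)
  then have "2 * b - 1 / a \<ge> 0"
    using assms(1-2) by (smt (verit) mult_nonneg_nonneg zero_le_power2 mult_pos_neg)
  then show u0: "0 \<le> u"
    using assms(7) by linarith
  have ua: "u \<le> 1 / a"
    using assms(7) by linarith
  have "m * u \<le> m * (1 / a)"
    using ua \<open>m > 0\<close> by (intro mult_left_mono) auto
  also have "4 * (m * (1 / a)) \<le> a"
    using am \<open>a > 0\<close> by (simp add: field_simps power2_eq_square)
  finally show mu: "4 * (m * u) \<le> a" by simp
  then have pos: "a - m * u > 0" using \<open>a > 0\<close> by linarith
  define q where "q = (a + 3 * m * b) / (a - m * u) - 2"
  have "slope_map m a u - b = (u - b) * q"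
  proof -
    have "1 + 2 * m * u\<^sup>2 - a * u - b * (a - m * u)
        = (u - b) * ((a + 3 * m * b) - 2 * (a - m * u)) + (3 * m * b\<^sup>2 - 2 * a * b + 1)"
      by (simp add: power2_eq_square algebra_simps)
    then have "1 + 2 * m * u\<^sup>2 - a * u - b * (a - m * u)
        = (u - b) * ((a + 3 * m * b) - 2 * (a - m * u))"
      using fp by simp
    then show ?thesis
      unfolding slope_map_def q_def using pos by (simp add: field_simps)
  qed
  \<comment> \<open>Both \<open>a + 3 * m * b \<le> 3 * a / 2\<close> and
    \<open>3 * a / 2 \<le> 2 * (a - m * u)\<close> hold.\<close>
  moreover have "q \<le> 0"
    unfolding q_def using pos mu mb by (simp add: field_simps)
  moreover have "q \<ge> 3 * m * b / a - 1"
  proof -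
    have "(a + 3 * m * b) / a \<le> (a + 3 * m * b) / (a - m * u)"
      using assms(1-3) u0 pos by (intro divide_left_mono) auto
    then show ?thesis
      using \<open>a > 0\<close> by (simp add: q_def add_divide_distrib)
  qed
  ultimately have "\<bar>slope_map m a u - b\<bar> = - q * \<bar>u - b\<bar>" "- q \<le> 1 - 3 * m * b / a"
    by (simp_all add: abs_mult)
  then show "\<bar>slope_map m a u - b\<bar> \<le> (1 - 3 * m * b / a) * \<bar>u - b\<bar>"
    by (simp only: mult_right_mono abs_ge_zero)
qed

text \<open>The starting value \<open>1 / a\<close> is the component ratio of the first direction,
  the negative gradient. The geometric error bound itself keeps each iterate in the interval where
  the contraction applies again.\<close>

lemma slope_map_iterates:
  fixes a b m :: real
  assumes "m > 0" "a > 0" "b > 0" and fp: "3 * m * b\<^sup>2 - 2 * a * b + 1 = 0"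
    and mb: "6 * (m * b) \<le> a" and am: "4 * m \<le> a\<^sup>2" and ba: "b \<le> 1 / a"
  shows "0 \<le> (slope_map m a ^^ k) (1 / a)" "4 * (m * (slope_map m a ^^ k) (1 / a)) \<le> a"
    and "(\<lambda>k. (slope_map m a ^^ k) (1 / a)) \<longlonglongrightarrow> b"
proof -
  define \<rho> where "\<rho> = 1 - 3 * m * b / a"
  define u where "u = (\<lambda>k. (slope_map m a ^^ k) (1 / a))"
  have \<rho>: "0 \<le> \<rho>" "\<rho> < 1"
    using assms(1-3) mb by (auto simp: \<rho>_def field_simps)
  have bound: "\<bar>u k - b\<bar> \<le> \<rho> ^ k * (1 / a - b)" for k
  proof (induction k)
    case 0
    then show ?case using ba by (simp add: u_def)
  next
    case (Suc k)
    have "\<rho> ^ k * (1 / a - b) \<le> 1 / a - b"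
      using \<rho> ba by (intro mult_left_le_one_le) (auto intro: power_le_one)
    then have "\<bar>u k - b\<bar> \<le> 1 / a - b" using Suc by linarith
    from slope_map_contraction(3)[OF assms(1-6) this]
    have "\<bar>u (Suc k) - b\<bar> \<le> \<rho> * \<bar>u k - b\<bar>"
      by (simp add: u_def \<rho>_def)
    also have "\<dots> \<le> \<rho> * (\<rho> ^ k * (1 / a - b))"
      using Suc \<rho> by (intro mult_left_mono) auto
    finally show ?case by (simp add: mult.assoc)
  qed
  have near: "\<bar>u k - b\<bar> \<le> 1 / a - b" for k
  proof -
    have "\<rho> ^ k * (1 / a - b) \<le> 1 / a - b"
      using \<rho> ba by (intro mult_left_le_one_le) (auto intro: power_le_one)
    then show ?thesis using bound[of k] by linarith
  qed
  show "0 \<le> (slope_map m a ^^ k) (1 / a)" "4 * (m * (slope_map m a ^^ k) (1 / a)) \<le> a"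
    using slope_map_contraction(1-2)[OF assms(1-6) near[of k]] by (auto simp: u_def)
  have "(\<lambda>k. \<rho> ^ k * (1 / a - b)) \<longlonglongrightarrow> 0"
    using \<rho> by (intro tendsto_mult_left_zero LIMSEQ_realpow_zero)
  then have "(\<lambda>k. u k - b) \<longlonglongrightarrow> 0"
    by (rule Lim_null_comparison[rotated]) (use bound in auto)
  then show "(\<lambda>k. (slope_map m a ^^ k) (1 / a)) \<longlonglongrightarrow> b"
    by (simp add: LIM_zero_iff u_def)
qed

section \<open>Summability of the distances to the kink\<close>

text \<open>Solving \<open>step\<close> for \<open>z (Suc k)\<close> gives the ratio bound
  \<open>R (m * u k)\<close>. \<open>R\<close> is continuous at \<open>\<beta>\<close>, and
  \<open>R \<beta> < 1\<close> is equivalent to \<open>(1 - c1) * \<beta> < c1 * a\<close>, so the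
  ratio test applies from some index on.\<close>

lemma summable_of_armijo:
  fixes z u :: "nat \<Rightarrow> real"
  assumes z: "\<And>k. z k > 0" and u: "\<And>k. 0 \<le> m * u k" "\<And>k. 4 * (m * u k) \<le> a" and "a > 0"
    and lim: "(\<lambda>k. m * u k) \<longlonglongrightarrow> \<beta>" and c1: "0 < c1" "c1 < 1" and "(1 - c1) * \<beta> < c1 * a"
    and step: "\<And>k. z (Suc k) * (a - m * u k + c1 * (a + m * u k)) \<le> (1 - c1) * (a + m * u k) * z k"
  shows "summable z"
proof -
  define R where "R = (\<lambda>v. (1 - c1) * (a + v) / (a - v + c1 * (a + v)))"
  have pos: "a - v + c1 * (a + v) > 0" if "0 \<le> v" "4 * v \<le> a" for v
    using that \<open>a > 0\<close> c1 by (smt (verit) mult_nonneg_nonneg)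
  have \<beta>: "0 \<le> \<beta>" "4 * \<beta> \<le> a"
    using LIMSEQ_le_const[OF lim] LIMSEQ_le_const2[OF lim, of "a / 4"] u by (auto simp: field_simps)
  have "(\<lambda>k. R (m * u k)) \<longlonglongrightarrow> R \<beta>"
    unfolding R_def using pos[OF \<beta>] by (intro tendsto_intros lim) auto
  moreover have "R \<beta> < 1"
    unfolding R_def using pos[OF \<beta>] assms(8) by (simp add: algebra_simps)
  then obtain q where q: "R \<beta> < q" "q < 1" using dense by blast
  ultimately have "\<forall>\<^sub>F k in sequentially. R (m * u k) < q"
    by (auto dest: order_tendstoD)
  then obtain N where N: "\<And>k. k \<ge> N \<Longrightarrow> R (m * u k) < q"
    by (auto simp: eventually_sequentially)
  show ?thesis
  proof (rule summable_ratio_test[OF q(2)])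
    fix k assume "N \<le> k"
    have "z (Suc k) \<le> R (m * u k) * z k"
      using step[of k] pos[OF u, of k] unfolding R_def by (simp add: field_simps)
    also have "\<dots> \<le> q * z k"
      using N[OF \<open>N \<le> k\<close>] z[of k] by (intro mult_right_mono) auto
    finally show "norm (z (Suc k)) \<le> q * norm (z k)"
      using z[of k] z[of "Suc k"] by simp
  qed
qed

section \<open>Armijo-Wolfe steps across the kink\<close>

lemma armijo_wolfe_stepD:
  fixes x :: "real ^ 'n::finite"
  assumes xp: "x $ p \<noteq> 0" and "D > 0" "a > 0" "0 \<le> m * u" "c2 < 1"
    and m: "m = real CARD('n) - 1"
    and d: "d = split_vec p (- (sgn (x $ p) * D)) (- (u * D))"
    and aw: "armijo_wolfe_step (abs_lin p a) c1 c2 x d t"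
    and x': "x' = x + t *\<^sub>R d"
  shows "t > 0" "sgn (x' $ p) = - sgn (x $ p)"
    and "abs_lin p a x' = abs_lin p a x + a * (\<bar>x' $ p\<bar> - \<bar>x $ p\<bar>) - m * u * (\<bar>x $ p\<bar> + \<bar>x' $ p\<bar>)"
    and "\<bar>x' $ p\<bar> * (a - m * u + c1 * (a + m * u)) \<le> (1 - c1) * (a + m * u) * \<bar>x $ p\<bar>"
proof -
  from aw have t: "t > 0" and arm: "armijo (abs_lin p a) c1 x d t" and w: "wolfe (abs_lin p a) c2 x d t"
    by (auto simp: armijo_wolfe_step_def)
  show "t > 0" by fact
  have x'p: "x' $ p \<noteq> 0"
    using w not_GDERIV_abs_lin[of x' p a] \<open>a > 0\<close> unfolding wolfe_def x'[symmetric] by auto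
  have gd: "gradient (abs_lin p a) y \<bullet> d = - (sgn (y $ p) * sgn (x $ p) * (a * D)) - m * (u * D)"
    if "y $ p \<noteq> 0" for y :: "real ^ 'n"
    by (simp add: gradient_abs_lin[OF that] d inner_split_vec flip: m)
  have gx: "gradient (abs_lin p a) x \<bullet> d = - ((a + m * u) * D)"
    using xp by (simp add: gd[OF xp] sgn_if algebra_simps)
  have neg: "(a + m * u) * D > 0"
    using assms(2-4) by (intro mult_pos_pos) auto
  \<comment> \<open>Without a sign change the slope along \<open>d\<close> would keep its negative
    initial value, against the Wolfe condition as \<open>c2 < 1\<close>.\<close>
  have "sgn (x' $ p) \<noteq> sgn (x $ p)"
  proof
    assume "sgn (x' $ p) = sgn (x $ p)"
    then have "gradient (abs_lin p a) x' \<bullet> d = - ((a + m * u) * D)"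
      using xp by (simp add: gd[OF x'p] sgn_if algebra_simps)
    then have "- ((a + m * u) * D) \<ge> c2 * (- ((a + m * u) * D))"
      using w unfolding wolfe_def x'[symmetric] gx by simp
    then have "(1 - c2) * ((a + m * u) * D) \<le> 0" by (simp add: algebra_simps)
    then show False using mult_pos_pos[OF _ neg, of "1 - c2"] \<open>c2 < 1\<close> by simp
  qed
  then show sg: "sgn (x' $ p) = - sgn (x $ p)"
    using xp x'p by (auto simp: sgn_if split: if_splits)
  have "x' $ p = x $ p - t * (sgn (x $ p) * D)"
    by (simp add: x' d)
  \<comment> \<open>Coordinate \<open>p\<close> travels \<open>t * D\<close> and passes through 0,
    covering both distances.\<close>
  then have tD: "t * D = \<bar>x $ p\<bar> + \<bar>x' $ p\<bar>"
    using sg xp x'p by (auto simp: sgn_if split: if_splits)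
  have "abs_lin p a x' = abs_lin p a x + a * (\<bar>x $ p + t * (- (sgn (x $ p) * D))\<bar> - \<bar>x $ p\<bar>)
      + m * (t * (- (u * D)))"
    unfolding x' d m by (rule abs_lin_line)
  also have "x $ p + t * (- (sgn (x $ p) * D)) = x' $ p"
    by (simp add: x' d)
  also have "m * (t * (- (u * D))) = - (m * u * (t * D))" by simp
  finally show f: "abs_lin p a x' = abs_lin p a x + a * (\<bar>x' $ p\<bar> - \<bar>x $ p\<bar>)
      - m * u * (\<bar>x $ p\<bar> + \<bar>x' $ p\<bar>)"
    by (simp add: tD)
  have "abs_lin p a x' \<le> abs_lin p a x + c1 * t * (- ((a + m * u) * D))"
    using arm unfolding armijo_def gx x'[symmetric] .
  also have "c1 * t * (- ((a + m * u) * D)) = - (c1 * (a + m * u) * (\<bar>x $ p\<bar> + \<bar>x' $ p\<bar>))"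
    unfolding tD[symmetric] by simp
  finally show "\<bar>x' $ p\<bar> * (a - m * u + c1 * (a + m * u)) \<le> (1 - c1) * (a + m * u) * \<bar>x $ p\<bar>"
    unfolding f by (simp add: algebra_simps)
qed

text \<open>The step for which the Armijo condition holds with equality lies beyond the kink.\<close>

lemma armijo_wolfe_step_exists:
  fixes x :: "real ^ 'n::finite"
  assumes xp: "x $ p \<noteq> 0" and "D > 0" "a > 0" "0 \<le> m * u" "m * u < a" "0 < c1" "c1 < 1" "0 < c2"
    and m: "m = real CARD('n) - 1"
    and d: "d = split_vec p (- (sgn (x $ p) * D)) (- (u * D))"
  shows "\<exists>t. armijo_wolfe_step (abs_lin p a) c1 c2 x d t"
proof -
  have pos: "a - m * u + c1 * (a + m * u) > 0"
    using assms(3-6) by (intro add_pos_nonneg mult_nonneg_nonneg) auto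
  define z where "z = \<bar>x $ p\<bar>"
  \<comment> \<open>The distance beyond the kink that turns the last inequality of
    \<open>armijo_wolfe_stepD\<close> into an equality.\<close>
  define z' where "z' = (1 - c1) * (a + m * u) * z / (a - m * u + c1 * (a + m * u))"
  define t where "t = (z + z') / D"
  define x' where "x' = x + t *\<^sub>R d"
  have "z > 0" using xp by (simp add: z_def)
  then have "z' > 0"
    unfolding z'_def using assms(2-8) pos by (intro divide_pos_pos mult_pos_pos) auto
  have "t > 0" unfolding t_def using \<open>z > 0\<close> \<open>z' > 0\<close> \<open>D > 0\<close> by simp
  have tD: "t * D = z + z'" using \<open>D > 0\<close> by (simp add: t_def)
  have "x' $ p = x $ p - sgn (x $ p) * (t * D)"
    by (simp add: x'_def d)
  also have "\<dots> = - (sgn (x $ p) * z')"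
    unfolding tD z_def by (auto simp: sgn_if algebra_simps)
  finally have x'p: "x' $ p = - (sgn (x $ p) * z')" .
  then have "x' $ p \<noteq> 0" using xp \<open>z' > 0\<close> by (simp add: sgn_zero_iff)
  have gd: "gradient (abs_lin p a) y \<bullet> d = - (sgn (y $ p) * sgn (x $ p) * (a * D)) - m * (u * D)"
    if "y $ p \<noteq> 0" for y :: "real ^ 'n"
    by (simp add: gradient_abs_lin[OF that] d inner_split_vec flip: m)
  have gx: "gradient (abs_lin p a) x \<bullet> d = - ((a + m * u) * D)"
    using xp by (simp add: gd[OF xp] sgn_if algebra_simps)
  \<comment> \<open>Beyond the kink the slope is positive because \<open>m * u < a\<close>, while
    the Wolfe bound is negative.\<close>
  have gx': "gradient (abs_lin p a) x' \<bullet> d = (a - m * u) * D"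
    using xp \<open>z' > 0\<close> by (simp add: gd[OF \<open>x' $ p \<noteq> 0\<close>] x'p sgn_if algebra_simps)
  have "wolfe (abs_lin p a) c2 x d t"
    unfolding wolfe_def x'_def[symmetric] gx gx'
  proof
    show "\<exists>g. GDERIV (abs_lin p a) x' :> g"
      using GDERIV_abs_lin[OF \<open>x' $ p \<noteq> 0\<close>] by blast
    have "c2 * ((a + m * u) * D) \<ge> 0" "(a - m * u) * D \<ge> 0"
      using assms(2-5,8) by (auto intro!: mult_nonneg_nonneg)
    then show "c2 * - ((a + m * u) * D) \<le> (a - m * u) * D" by simp
  qed
  moreover have "armijo (abs_lin p a) c1 x d t"
  proof -
    have "abs_lin p a x' = abs_lin p a x + a * (\<bar>x $ p + t * (- (sgn (x $ p) * D))\<bar> - \<bar>x $ p\<bar>)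
        + m * (t * (- (u * D)))"
      unfolding x'_def d m by (rule abs_lin_line)
    also have "x $ p + t * (- (sgn (x $ p) * D)) = x' $ p"
      by (simp add: x'_def d)
    also have "\<bar>x' $ p\<bar> = z'"
      using xp \<open>z' > 0\<close> by (simp add: x'p abs_mult)
    also have "m * (t * (- (u * D))) = - (m * u * (t * D))" by simp
    finally have "abs_lin p a x' = abs_lin p a x + a * (z' - z) - m * u * (z + z')"
      by (simp add: tD z_def)
    moreover have "c1 * t * (- ((a + m * u) * D)) = - (c1 * (a + m * u) * (z + z'))"
      unfolding tD[symmetric] by simp
    moreover have "z' * (a - m * u + c1 * (a + m * u)) = (1 - c1) * (a + m * u) * z"
      using pos by (simp add: z'_def)
    ultimately show ?thesis
      unfolding armijo_def gx x'_def[symmetric] by (simp add: algebra_simps)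
  qed
  ultimately show ?thesis
    using \<open>t > 0\<close> unfolding armijo_wolfe_step_def by blast
qed

section \<open>Boundedness of the objective along a run\<close>

theorem theorem10:
  fixes p :: "'n::finite"
    and a b c1 c2 :: real
    and x0 :: "real ^ 'n"
    and K :: enat
    and x d :: "nat \<Rightarrow> real ^ 'n"
    and t :: "nat \<Rightarrow> real"
  assumes "CARD('n) \<ge> 2"
    and "a \<ge> 2 * sqrt (real CARD('n) - 1)"
    and "b = (a - sqrt (a\<^sup>2 - 3 * (real CARD('n) - 1))) / (3 * (real CARD('n) - 1))"
    and "0 < c1" and "c1 < c2" and "c2 < 1"
    and "1 / c1 - 1 < a / ((real CARD('n) - 1) * b)"
    and "x0 $ p \<noteq> 0"
    and "memoryless_bfgs_run (abs_lin p a) c1 c2 x0 K x d t"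
  shows "K = \<infinity> \<and> bdd_below (range (\<lambda>N. abs_lin p a (x N)))"
proof -
  define m where "m = real CARD('n) - 1"
  have m: "m > 0" using assms(1) by (simp add: m_def)
  note b_props = slope_fixpoint[OF m assms(2,3)[folded m_def]]
  define u where "u = (\<lambda>k. (slope_map m a ^^ k) (1 / a))"
  have it: "0 \<le> u k" "4 * (m * u k) \<le> a" "u \<longlonglongrightarrow> b" for k
    using slope_map_iterates[OF m b_props(5,2,1,3,6,4)] by (simp_all add: u_def)
  have a: "a > 0" by (fact b_props(5))
  have mu0: "0 \<le> m * u k" for k using m it(1) by simp
  have mua: "m * u k < a" for k using it(2)[of k] a by linarith
  from assms(9) have run0: "x 0 = x0" "d 0 = - gradient (abs_lin p a) x0"
    and step: "\<And>k. enat k < K \<Longrightarrow> armijo_wolfe_step (abs_lin p a) c1 c2 (x k) (d k) (t k)"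
    and xS: "\<And>k. enat k < K \<Longrightarrow> x (Suc k) = x k + t k *\<^sub>R d k"
    and dS: "\<And>k. enat k < K \<Longrightarrow> d (Suc k) = - (bfgs_H (x (Suc k) - x k)
        (gradient (abs_lin p a) (x (Suc k)) - gradient (abs_lin p a) (x k))
          *v gradient (abs_lin p a) (x (Suc k)))"
    and stop: "\<And>k. K = enat k \<Longrightarrow> \<nexists>\<tau>. armijo_wolfe_step (abs_lin p a) c1 c2 (x k) (d k) \<tau>"
    unfolding memoryless_bfgs_run_def by blast+
  \<comment> \<open>The case \<open>k = K\<close> is included so that, for finite \<open>K\<close>,
    a step exists at the last iterate and contradicts termination.\<close>
  have inv: "x k $ p \<noteq> 0 \<and> (\<exists>D>0. d k = split_vec p (- (sgn (x k $ p) * D)) (- (u k * D)))"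
    if "enat k \<le> K" for k
    using that
  proof (induction k)
    case 0
    \<comment> \<open>Here \<open>D = a\<close>, which matches \<open>u 0 = 1 / a\<close>.\<close>
    have "d 0 = split_vec p (- (sgn (x 0 $ p) * a)) (- (u 0 * a))"
      using a assms(8) by (simp add: run0 gradient_abs_lin split_vec_arith u_def mult.commute)
    then show ?case using a assms(8) run0(1) by auto
  next
    case (Suc k)
    then have k: "enat k < K" by (simp add: Suc_ile_eq)
    with Suc.IH obtain D where xk: "x k $ p \<noteq> 0" and D: "D > 0"
      and dk: "d k = split_vec p (- (sgn (x k $ p) * D)) (- (u k * D))"
      by (auto dest: less_imp_le)
    note s = armijo_wolfe_stepD[OF xk D a mu0 assms(6) m_def dk step[OF k] xS[OF k]]
    define \<sigma> where "\<sigma> = sgn (x (Suc k) $ p)"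
    have \<sigma>: "\<sigma> = 1 \<or> \<sigma> = -1" "sgn (x k $ p) = - \<sigma>" and xk': "x (Suc k) $ p \<noteq> 0"
      using s(2) xk by (auto simp: \<sigma>_def sgn_if split: if_splits)
    define E where "E = t k * D * (a - m * u k) / (2 * a)"
    have E: "E > 0"
      unfolding E_def using s(1) D mua a by (intro divide_pos_pos mult_pos_pos) auto
    have g: "gradient (abs_lin p a) (x (Suc k)) = split_vec p (a * \<sigma>) 1"
      using gradient_abs_lin[OF xk'] by (simp only: \<sigma>_def)
    have y: "gradient (abs_lin p a) (x (Suc k)) - gradient (abs_lin p a) (x k) = split_vec p (2 * a * \<sigma>) 0"
      unfolding g gradient_abs_lin[OF xk] \<sigma>(2) split_vec_arith by (simp add: mult_ac)
    have s': "x (Suc k) - x k = t k *\<^sub>R split_vec p (\<sigma> * D) (- (u k * D))"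
      using xS[OF k] by (simp add: dk \<sigma>(2))
    have "a - m * u k > 0" using mua[of k] by simp
    from bfgs_direction[OF \<sigma>(1) D s(1) a m_def this, of p]
    have "d (Suc k) = - (E *\<^sub>R split_vec p \<sigma> (slope_map m a (u k)))"
      unfolding dS[OF k] y s' unfolding g E_def by simp
    then have "d (Suc k) = split_vec p (- (sgn (x (Suc k) $ p) * E)) (- (u (Suc k) * E))"
      by (simp add: split_vec_arith u_def \<sigma>_def mult.commute)
    then show ?case using xk' E by blast
  qed
  have K: "K = \<infinity>"
  proof (rule ccontr)
    assume "K \<noteq> \<infinity>"
    then obtain k where k: "K = enat k" by auto
    with inv[of k] obtain D where xk: "x k $ p \<noteq> 0" and D: "D > 0"
      and dk: "d k = split_vec p (- (sgn (x k $ p) * D)) (- (u k * D))" by auto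
    show False
      using armijo_wolfe_step_exists[OF xk D a mu0 mua, of c1 c2, OF _ _ _ m_def dk] stop[OF k] assms(4-6)
      by auto
  qed
  define z where "z = (\<lambda>k. \<bar>x k $ p\<bar>)"
  have z: "z k > 0" for k using inv[of k] K by (simp add: z_def)
  have fS: "abs_lin p a (x (Suc k)) = abs_lin p a (x k) + a * (z (Suc k) - z k) - m * u k * (z k + z (Suc k))"
    and zS: "z (Suc k) * (a - m * u k + c1 * (a + m * u k)) \<le> (1 - c1) * (a + m * u k) * z k" for k
  proof -
    have k: "enat k < K" using K by simp
    from inv[of k] K obtain D where xk: "x k $ p \<noteq> 0" and D: "D > 0"
      and dk: "d k = split_vec p (- (sgn (x k $ p) * D)) (- (u k * D))" by auto
    note s = armijo_wolfe_stepD[OF xk D a mu0 assms(6) m_def dk step[OF k] xS[OF k]]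
    show "abs_lin p a (x (Suc k)) = abs_lin p a (x k) + a * (z (Suc k) - z k) - m * u k * (z k + z (Suc k))"
      "z (Suc k) * (a - m * u k + c1 * (a + m * u k)) \<le> (1 - c1) * (a + m * u k) * z k"
      using s(3,4) by (simp_all add: z_def)
  qed
  have "summable z"
  proof (rule summable_of_armijo[OF z mu0 it(2) a])
    show "(\<lambda>k. m * u k) \<longlonglongrightarrow> m * b"
      by (intro tendsto_intros it(3))
    \<comment> \<open>The hypothesis on \<open>c1\<close>, multiplied by
      \<open>c1 * (m * b)\<close>.\<close>
    show "(1 - c1) * (m * b) < c1 * a"
      using assms(7)[folded m_def] m b_props(2) assms(4) by (simp add: field_simps)
  qed (use assms(4-6) zS in auto)
  \<comment> \<open>The terms \<open>a * (z (Suc k) - z k)\<close> telescope; as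
    \<open>m * u k < a\<close>, the other loss in each step is at most
    \<open>a * (z k + z (Suc k))\<close>.\<close>
  have lower: "abs_lin p a (x 0) + a * (z N - z 0) - a * (\<Sum>k<N. z k + z (Suc k)) \<le> abs_lin p a (x N)" for N
  proof (induction N)
    case (Suc N)
    have "m * u N * (z N + z (Suc N)) \<le> a * (z N + z (Suc N))"
      using mua[of N] z[of N] z[of "Suc N"] by (intro mult_right_mono) auto
    then show ?case using Suc fS[of N] by (simp add: algebra_simps)
  qed simp
  have sum_le: "a * (\<Sum>k<N. z k + z (Suc k)) \<le> a * (\<Sum>k. z k + z (Suc k))" for N
    using \<open>summable z\<close> z a
    by (intro mult_left_mono sum_le_suminf summable_add)
       (auto simp: summable_Suc_iff add_nonneg_nonneg less_imp_le)
  have "abs_lin p a (x 0) - a * z 0 - a * (\<Sum>k. z k + z (Suc k)) \<le> abs_lin p a (x N)" for N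
    using lower[of N] sum_le[of N] mult_pos_pos[OF a z[of N]]
    unfolding right_diff_distrib by linarith
  then have "bdd_below (range (\<lambda>N. abs_lin p a (x N)))"
    by (auto simp: bdd_below_def)
  then show ?thesis using K by simp
qed

end
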